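(* For every integer $d\ge 1$, there is a finite poset $P$ such that $\operatorname{ldim}(P)=d$ while $\operatorname{ldim}(B)\le 3$ for every block $B$ of $P$.
   Context: All posets are finite. A partial linear extension (ple) of a poset $P$ is a linear extension of a subposet of $P$. For a family $\mathcal{L}$ of ple's of $P$ and $u\in P$, let $\mu(u,\mathcal{L})=|\{L\in\mathcal{L}: u\in L\}|$ and $\mu(P,\mathcal{L})=\max_{u\in P}\mu(u,\mathcal{L})$. A family $\mathcal{L}$ of ple's of $P$ is a local realizer of $P$ if (1) whenever $x<y$ in $P$ there is $L\in\mathcal{L}$ with $x<y$ in $L$, and (2) whenever $x$ and $y$ are incomparable in $P$ there is $L\in\mathcal{L}$ with $x>y$ in $L$. The local dimension $\operatorname{ldim}(P)$ is the least positive integer $d$ such that $P$ has a local realizer $\mathcal{L}$ with $\mu(P,\mathcal{L})=d$. The cover graph of $P$ is the graph on the elements of $P$ in which $x,y$ are adjacent iff one covers the other. A subposet $B$ of $P$ is convex if $y\in B$ whenever $x,z\in B$ and $x<y<z$ in $P$. A block of $P$ is a convex subposet $B$ of $P$ whose cover graph is a block (maximal $2$-connected subgraph) of the cover graph of $P$. *)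

theory Defs
  imports "Graph_Theory.Graph_Theory"
begin

text \<open>
  A poset is a carrier \<open>A\<close> with a reflexive relation \<open>r\<close> such that \<^term>\<open>partial_order_on A r\<close>;
  its subposet on \<open>B \<subseteq> A\<close> is \<open>B\<close> with \<open>Restr r B\<close>. Linear extensions are reflexive as well, so
  the ground set of a linear extension \<open>L\<close> is \<^term>\<open>Field L\<close>.
\<close>

definition linear_extension :: "'a set \<Rightarrow> 'a rel \<Rightarrow> 'a rel \<Rightarrow> bool" where
  "linear_extension A r L \<longleftrightarrow> linear_order_on A L \<and> r \<subseteq> L"

definition ple :: "'a set \<Rightarrow> 'a rel \<Rightarrow> 'a rel \<Rightarrow> bool" where
  "ple A r L \<longleftrightarrow> (\<exists>X\<subseteq>A. linear_extension X (Restr r X) L)"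

definition mu_at :: "'a \<Rightarrow> 'a rel set \<Rightarrow> nat" where
  "mu_at u \<L> = card {L \<in> \<L>. u \<in> Field L}"

text \<open>Only meaningful for finite nonempty \<open>A\<close>, because of \<^const>\<open>Max\<close>.\<close>

definition mu :: "'a set \<Rightarrow> 'a rel set \<Rightarrow> nat" where
  "mu A \<L> = Max ((\<lambda>u. mu_at u \<L>) ` A)"

text \<open>
  In both clauses \<open>x \<noteq> y\<close>, so membership in the reflexive linear order \<open>L\<close> is strict comparison.
  The second clause applies to \<open>(x, y)\<close> and to \<open>(y, x)\<close>, so an incomparable pair is reversed
  in both directions.
\<close>

definition local_realizer :: "'a set \<Rightarrow> 'a rel \<Rightarrow> 'a rel set \<Rightarrow> bool" where
  "local_realizer A r \<L> \<longleftrightarrow>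
     (\<forall>L\<in>\<L>. ple A r L) \<and>
     (\<forall>x\<in>A. \<forall>y\<in>A. (x, y) \<in> r \<and> x \<noteq> y \<longrightarrow> (\<exists>L\<in>\<L>. (x, y) \<in> L)) \<and>
     (\<forall>x\<in>A. \<forall>y\<in>A. (x, y) \<notin> r \<and> (y, x) \<notin> r \<longrightarrow> (\<exists>L\<in>\<L>. (y, x) \<in> L))"

definition ldim :: "'a set \<Rightarrow> 'a rel \<Rightarrow> nat" where
  "ldim A r = (LEAST d. d > 0 \<and> (\<exists>\<L>. local_realizer A r \<L> \<and> mu A \<L> = d))"

definition covers :: "'a set \<Rightarrow> 'a rel \<Rightarrow> 'a \<Rightarrow> 'a \<Rightarrow> bool" where
  "covers A r y x \<longleftrightarrow> x \<in> A \<and> y \<in> A \<and> (x, y) \<in> r \<and> x \<noteq> y \<and>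
     (\<forall>z\<in>A. (x, z) \<in> r \<and> (z, y) \<in> r \<longrightarrow> z = x \<or> z = y)"

definition cover_graph :: "'a set \<Rightarrow> 'a rel \<Rightarrow> 'a pair_pre_digraph" where
  "cover_graph A r =
     \<lparr>pverts = A, parcs = {(x, y). covers A r x y \<or> covers A r y x}\<rparr>"

text \<open>
  Connected without a cut vertex. As usual for blocks, the one-vertex graph and the single edge
  count as 2-connected, so isolated vertices and bridges are blocks too. \<^const>\<open>connected\<close>
  includes nonemptiness.
\<close>

definition two_connected :: "('a, 'b) pre_digraph \<Rightarrow> bool" where
  "two_connected G \<longleftrightarrow> graph G \<and> connected G \<and>
     (\<forall>v\<in>verts G. verts G \<noteq> {v} \<longrightarrow> connected (pre_digraph.del_vert G v))"

definition graph_block :: "('a, 'b) pre_digraph \<Rightarrow> ('a, 'b) pre_digraph \<Rightarrow> bool" where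
  "graph_block G H \<longleftrightarrow> pre_digraph.max_subgraph G two_connected H"

definition convex_subposet :: "'a set \<Rightarrow> 'a rel \<Rightarrow> 'a set \<Rightarrow> bool" where
  "convex_subposet A r B \<longleftrightarrow> B \<subseteq> A \<and>
     (\<forall>x\<in>B. \<forall>z\<in>B. \<forall>y\<in>A. (x, y) \<in> r \<and> (y, z) \<in> r \<longrightarrow> y \<in> B)"

definition poset_block :: "'a set \<Rightarrow> 'a rel \<Rightarrow> 'a set \<Rightarrow> bool" where
  "poset_block A r B \<longleftrightarrow> convex_subposet A r B \<and>
     graph_block (with_proj (cover_graph A r)) (with_proj (cover_graph B (Restr r B)))"

end

theory Submission
  imports Defs "HOL-Library.List_Lexorder" "HOL-Library.Sublist" "HOL-Library.Countable"
begin

text \<open>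
  Hang standard examples on top of each other along a tree of depth \<open>h\<close> with \<open>n\<close> children at
  each node. A leaf has to be put above one peak for every node on its path. A partial linear
  extension cannot do this for two siblings at once, so the families serving siblings are
  disjoint, and if \<open>n\<close> is large one can walk greedily to a leaf whose \<open>h\<close> reversals happen in
  \<open>h\<close> different members, none of which contains a fixed node incomparable to that leaf. The
  two orders between the leaf and this node need two more members, so the local dimension is at
  least \<open>h + 2\<close>. Two postorder traversals, a breadth-first order and one small partial linear
  extension per branch show equality for \<open>h \<ge> 2\<close>.

  Every inner node separates what hangs below it from the rest of the cover graph, so a block
  lies in a single standard example with one additional element above all its minimal elements.
  Such a poset has local dimension at most 3, which also settles \<open>h = 1\<close>.
\<close>

subsection \<open>Local realizers\<close>

lemma pleD:
  assumes "ple A r L"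
  shows "linear_order_on (Field L) L" "Field L \<subseteq> A" "Restr r (Field L) \<subseteq> L" "L \<subseteq> A \<times> A"
proof -
  obtain X where X: "X \<subseteq> A" "linear_order_on X L" "Restr r X \<subseteq> L"
    using assms by (auto simp: ple_def linear_extension_def)
  have "Field L = X"
    using X(2) by (auto simp: order_on_defs refl_on_def Field_def)
  with X show "linear_order_on (Field L) L" "Field L \<subseteq> A" "Restr r (Field L) \<subseteq> L"
    by auto
  show "L \<subseteq> A \<times> A"
    using \<open>Field L \<subseteq> A\<close> by (auto simp: Field_def)
qed

lemma ple_refl: "ple A r L \<Longrightarrow> u \<in> Field L \<Longrightarrow> (u, u) \<in> L"
  by (drule pleD(1)) (auto simp: order_on_defs refl_on_def)

lemma ple_antisym: "ple A r L \<Longrightarrow> (u, v) \<in> L \<Longrightarrow> (v, u) \<in> L \<Longrightarrow> u = v"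
  by (drule pleD(1)) (auto simp: order_on_defs antisym_def)

lemma ple_trans: "ple A r L \<Longrightarrow> (u, v) \<in> L \<Longrightarrow> (v, w) \<in> L \<Longrightarrow> (u, w) \<in> L"
  by (drule pleD(1)) (auto simp: order_on_defs trans_def)

lemma finite_ples:
  assumes "finite A" "local_realizer A r \<L>"
  shows "finite \<L>"
proof (rule finite_subset)
  show "\<L> \<subseteq> Pow (A \<times> A)"
    using assms(2) pleD(4) by (auto simp: local_realizer_def)
qed (use assms in auto)

lemma local_realizer_ple: "local_realizer A r \<L> \<Longrightarrow> L \<in> \<L> \<Longrightarrow> ple A r L"
  by (simp add: local_realizer_def)

lemma mu_at_pos:
  assumes "finite A" "local_realizer A r \<L>" "L \<in> \<L>" "u \<in> Field L"
  shows "1 \<le> mu_at u \<L>"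
proof -
  have "finite {L \<in> \<L>. u \<in> Field L}" using finite_ples[OF assms(1,2)] by simp
  with assms(3,4) have "card {L \<in> \<L>. u \<in> Field L} > 0" by (auto simp: card_gt_0_iff)
  then show ?thesis by (simp add: mu_at_def)
qed

text \<open>The lower bound 1 keeps \<open>mu\<close> positive, as \<open>ldim\<close> demands: the
  empty family realizes a one-element poset with \<open>mu\<close> equal to 0. Both bounds are
  pointwise so that they pass to subposets.\<close>

definition realizable :: "'a set \<Rightarrow> 'a rel \<Rightarrow> nat \<Rightarrow> bool" where
  "realizable A r k \<longleftrightarrow>
     (\<exists>\<L>. local_realizer A r \<L> \<and> (\<forall>u\<in>A. 1 \<le> mu_at u \<L> \<and> mu_at u \<L> \<le> k))"

lemma realizable_mu:
  assumes "realizable A r k" "finite A" "A \<noteq> {}"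
  obtains \<L> where "local_realizer A r \<L>" "mu A \<L> > 0" "mu A \<L> \<le> k"
proof -
  obtain \<L> where L: "local_realizer A r \<L>" "\<forall>u\<in>A. 1 \<le> mu_at u \<L> \<and> mu_at u \<L> \<le> k"
    using assms by (auto simp: realizable_def)
  have "mu A \<L> \<in> (\<lambda>u. mu_at u \<L>) ` A"
    unfolding mu_def using assms by (intro Max_in) auto
  with L that show thesis by fastforce
qed

lemma ldim_le:
  assumes "realizable A r k" "finite A" "A \<noteq> {}"
  shows "ldim A r \<le> k"
proof -
  obtain \<L> where L: "local_realizer A r \<L>" "mu A \<L> > 0" "mu A \<L> \<le> k"
    using realizable_mu[OF assms] .
  then have "ldim A r \<le> mu A \<L>"
    unfolding ldim_def by (intro Least_le) auto
  with L show ?thesis by simp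
qed

text \<open>\<open>LEAST\<close> is informative only once a candidate exists; realizability supplies
  one.\<close>

lemma ldim_attained:
  assumes "realizable A r m" "finite A" "A \<noteq> {}"
  obtains \<L> where "local_realizer A r \<L>" "mu A \<L> = ldim A r" "ldim A r > 0"
proof -
  define P where "P d \<longleftrightarrow> d > 0 \<and> (\<exists>\<L>. local_realizer A r \<L> \<and> mu A \<L> = d)" for d
  have "\<exists>d. P d"
    using realizable_mu[OF assms] unfolding P_def by metis
  then have "P (Least P)" by (rule LeastI_ex)
  moreover have "Least P = ldim A r"
    unfolding ldim_def P_def ..
  ultimately show thesis using that by (auto simp: P_def)
qed

lemma ldim_ge:
  assumes "realizable A r m" "finite A" "A \<noteq> {}"
    and "\<And>\<L>. local_realizer A r \<L> \<Longrightarrow> \<exists>u\<in>A. k \<le> mu_at u \<L>"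
  shows "k \<le> ldim A r"
proof -
  obtain \<L> where L: "local_realizer A r \<L>" "mu A \<L> = ldim A r"
    using ldim_attained[OF assms(1-3)] .
  obtain u where "u \<in> A" "k \<le> mu_at u \<L>" using assms(4) L(1) by blast
  moreover from \<open>u \<in> A\<close> have "mu_at u \<L> \<le> mu A \<L>"
    unfolding mu_def using assms(2) by (intro Max_ge) auto
  ultimately show ?thesis using L(2) by simp
qed

lemma ple_Restr:
  assumes "ple A r L"
  shows "ple B (Restr r B) (Restr L B)"
  unfolding ple_def linear_extension_def
proof (intro exI[of _ "Field L \<inter> B"] conjI)
  show "linear_order_on (Field L \<inter> B) (Restr L B)"
    using pleD(1)[OF assms]
    by (auto simp: order_on_defs refl_on_def trans_def antisym_def total_on_def Field_def)
  show "Restr (Restr r B) (Field L \<inter> B) \<subseteq> Restr L B"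
    using pleD(3)[OF assms] by auto
qed auto

text \<open>Restrict every member to \<open>B\<close>. By reflexivity an element of \<open>B\<close>
  stays in the same members, and members that become equal can lower a count, but never to
  0.\<close>

lemma realizable_subset:
  assumes "realizable A r k" "finite A" "B \<subseteq> A"
  shows "realizable B (Restr r B) k"
proof -
  obtain \<L> where L: "local_realizer A r \<L>" "\<forall>u\<in>A. 1 \<le> mu_at u \<L> \<and> mu_at u \<L> \<le> k"
    using assms by (auto simp: realizable_def)
  define \<L>' where "\<L>' = (\<lambda>L. Restr L B) ` \<L>"
  have ple: "ple A r L" if "L \<in> \<L>" for L
    using L that by (auto simp: local_realizer_def)
  have fin: "finite \<L>" using finite_ples[OF assms(2) L(1)] .
  have "local_realizer B (Restr r B) \<L>'"
    unfolding local_realizer_def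
  proof (intro conjI ballI impI)
    fix L assume "L \<in> \<L>'"
    then show "ple B (Restr r B) L"
      using ple by (auto simp: \<L>'_def intro: ple_Restr)
  next
    fix x y assume "x \<in> B" "y \<in> B" "(x, y) \<in> Restr r B \<and> x \<noteq> y"
    then obtain L where "L \<in> \<L>" "(x, y) \<in> L"
      using L(1) assms(3) unfolding local_realizer_def by blast
    with \<open>x \<in> B\<close> \<open>y \<in> B\<close> show "\<exists>L\<in>\<L>'. (x, y) \<in> L"
      by (auto simp: \<L>'_def)
  next
    fix x y assume "x \<in> B" "y \<in> B" "(x, y) \<notin> Restr r B \<and> (y, x) \<notin> Restr r B"
    then obtain L where "L \<in> \<L>" "(y, x) \<in> L"
      using L(1) assms(3) unfolding local_realizer_def by blast
    with \<open>x \<in> B\<close> \<open>y \<in> B\<close> show "\<exists>L\<in>\<L>'. (y, x) \<in> L"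
      by (auto simp: \<L>'_def)
  qed
  moreover have "1 \<le> mu_at u \<L>' \<and> mu_at u \<L>' \<le> k" if "u \<in> B" for u
  proof -
    have eq: "{L \<in> \<L>'. u \<in> Field L} = (\<lambda>L. Restr L B) ` {L \<in> \<L>. u \<in> Field L}" (is "?S' = _ ` ?S")
    proof -
      have "u \<in> Field (Restr L B) \<longleftrightarrow> u \<in> Field L" if "L \<in> \<L>" for L
        using ple_refl[OF ple[OF that], of u] \<open>u \<in> B\<close> by (auto simp: Field_def)
      then show ?thesis by (auto simp: \<L>'_def)
    qed
    have mu: "1 \<le> card ?S" "card ?S \<le> k"
      using L(2) that assms(3) by (auto simp: mu_at_def)
    have "card ?S' \<le> k"
      using card_image_le[of ?S "\<lambda>L. Restr L B"] fin mu(2) unfolding eq by auto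
    moreover have "?S \<noteq> {}" using mu(1) by (metis card.empty not_one_le_zero)
    then have "card ?S' > 0"
      using fin unfolding eq card_gt_0_iff by simp
    ultimately show ?thesis by (simp add: mu_at_def)
  qed
  ultimately show ?thesis by (auto simp: realizable_def)
qed

section \<open>Linear orders given by sort keys\<close>

definition keyed_order :: "'a set \<Rightarrow> ('a \<Rightarrow> 'k::linorder) \<Rightarrow> 'a rel" where
  "keyed_order X f = {(p, q). p \<in> X \<and> q \<in> X \<and> f p \<le> f q}"

lemma in_keyed_order: "(p, q) \<in> keyed_order X f \<longleftrightarrow> p \<in> X \<and> q \<in> X \<and> f p \<le> f q"
  by (simp add: keyed_order_def)

lemma Field_keyed_order [simp]: "Field (keyed_order X f) = X"
  by (auto simp: Field_def keyed_order_def)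

lemma ple_keyed_order:
  assumes "X \<subseteq> A" "inj_on f X"
    and "\<And>p q. p \<in> X \<Longrightarrow> q \<in> X \<Longrightarrow> (p, q) \<in> r \<Longrightarrow> f p \<le> f q"
  shows "ple A r (keyed_order X f)"
  unfolding ple_def linear_extension_def
proof (intro exI[of _ X] conjI)
  show "linear_order_on X (keyed_order X f)"
    using assms(2)
    by (auto simp: order_on_defs refl_on_def trans_def antisym_def total_on_def keyed_order_def
          inj_on_def)
qed (use assms in \<open>auto simp: keyed_order_def\<close>)

text \<open>Reversing all unrelated pairs is enough: if \<open>p\<close> is strictly below
  \<open>q\<close>, antisymmetry makes the swapped pair unrelated, and its reversal puts
  \<open>p\<close> below \<open>q\<close>.\<close>

lemma local_realizerI:
  assumes "antisym r" "\<And>L. L \<in> \<L> \<Longrightarrow> ple A r L"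
    and "\<And>p q. p \<in> A \<Longrightarrow> q \<in> A \<Longrightarrow> (p, q) \<notin> r \<Longrightarrow> \<exists>L\<in>\<L>. (q, p) \<in> L"
  shows "local_realizer A r \<L>"
  unfolding local_realizer_def using assms by (meson antisymD)

subsection \<open>Cut vertices\<close>

lemma connected_no_cut:
  assumes "connected G"
    and "\<And>e. e \<in> arcs G \<Longrightarrow> tail G e \<in> S \<longleftrightarrow> head G e \<in> S"
  shows "verts G \<subseteq> S \<or> verts G \<inter> S = {}"
proof -
  have "v \<in> S \<longleftrightarrow> u \<in> S" if "u \<in> verts G" "v \<in> verts G" for u v
  proof -
    have "(u, v) \<in> rtrancl_on (verts (mk_symmetric G)) (arcs_ends (mk_symmetric G))"
      using assms(1) that
      by (auto simp: connected_def strongly_connected_def reachable_def mk_symmetric_def)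
    then show ?thesis
      by (induction rule: rtrancl_on_induct) (use assms(2) in \<open>auto simp: mk_symmetric_def\<close>)
  qed
  then show ?thesis by blast
qed

text \<open>Unless \<open>c\<close> is the only vertex, the graph without \<open>c\<close> is
  connected, and none of its arcs crosses the border of \<open>S\<close>.\<close>

lemma two_connected_no_cut:
  assumes "two_connected H" "c \<notin> S"
    and "\<And>e. e \<in> arcs H \<Longrightarrow> tail H e \<noteq> c \<Longrightarrow> head H e \<noteq> c \<Longrightarrow> tail H e \<in> S \<longleftrightarrow> head H e \<in> S"
  shows "verts H \<subseteq> insert c S \<or> verts H \<inter> S = {}"
proof (cases "c \<in> verts H")
  case False
  interpret graph H using assms(1) by (simp add: two_connected_def)
  have "verts H \<subseteq> S \<or> verts H \<inter> S = {}"
  proof (rule connected_no_cut)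
    show "connected H" using assms(1) by (simp add: two_connected_def)
    fix e assume "e \<in> arcs H"
    then show "tail H e \<in> S \<longleftrightarrow> head H e \<in> S"
      using False tail_in_verts head_in_verts by (intro assms(3)) metis+
  qed
  then show ?thesis by auto
next
  case True
  show ?thesis
  proof (cases "verts H = {c}")
    case False
    then have "connected (pre_digraph.del_vert H c)"
      using assms(1) True by (auto simp: two_connected_def)
    then have "verts (pre_digraph.del_vert H c) \<subseteq> S \<or> verts (pre_digraph.del_vert H c) \<inter> S = {}"
      by (rule connected_no_cut) (use assms(3) in \<open>auto simp: pre_digraph.del_vert_def\<close>)
    then show ?thesis using assms(2) by (auto simp: pre_digraph.del_vert_def)
  qed auto
qed

subsection \<open>The tree poset\<close>

text \<open>
  A finite tree of nodes, given by their paths from the root, is ordered with the root on top.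
  The children \<open>v @ [i]\<close> of a node and the maximal elements \<open>peak v i\<close> form a standard
  example: \<open>peak v i\<close> lies above exactly the proper descendants of \<open>v\<close> that are not in the
  branch of its \<open>i\<close>-th child.
\<close>

definition node :: "nat list \<Rightarrow> nat" where
  "node x = to_nat (Inl x :: nat list + nat list \<times> nat)"

definition peak :: "nat list \<Rightarrow> nat \<Rightarrow> nat" where
  "peak v i = to_nat (Inr (v, i) :: nat list + nat list \<times> nat)"

text \<open>The carrier in the theorem consists of naturals, so elements are coded; this decodes
  them, so that keys can be given separately for nodes and peaks.\<close>

definition elem_case :: "(nat list \<Rightarrow> 'k) \<Rightarrow> (nat list \<Rightarrow> nat \<Rightarrow> 'k) \<Rightarrow> nat \<Rightarrow> 'k" where
  "elem_case f g p = case_sum f (case_prod g) (from_nat p)"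

lemma node_peak_simps [simp]:
  "node x = node y \<longleftrightarrow> x = y"
  "peak v i = peak w j \<longleftrightarrow> v = w \<and> i = j"
  "node x \<noteq> peak v i" "peak v i \<noteq> node x"
  by (auto simp: node_def peak_def)

lemma elem_case_simps [simp]:
  "elem_case f g (node x) = f x"
  "elem_case f g (peak v i) = g v i"
  by (auto simp: node_def peak_def elem_case_def)

inductive tree_le :: "nat \<Rightarrow> nat \<Rightarrow> bool" where
  node_node: "tree_le (node (y @ z)) (node y)"
| node_peak: "i \<noteq> j \<Longrightarrow> tree_le (node (v @ j # z)) (peak v i)"
| peak_peak: "tree_le (peak v i) (peak v i)"

lemma tree_le_simps [simp]:
  "tree_le (node x) (node y) \<longleftrightarrow> prefix y x"
  "tree_le (node x) (peak v i) \<longleftrightarrow> (\<exists>j z. x = v @ j # z \<and> i \<noteq> j)"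
  "\<not> tree_le (peak v i) (node x)"
  "tree_le (peak v i) (peak w j) \<longleftrightarrow> v = w \<and> i = j"
  by (auto simp: tree_le.simps[of "node x"] tree_le.simps[of "peak v i"] prefix_def)

definition nodes :: "nat \<Rightarrow> nat \<Rightarrow> nat list set" where
  "nodes h n = {x. length x \<le> h \<and> set x \<subseteq> {..<n}}"

definition tree_elems :: "nat \<Rightarrow> nat \<Rightarrow> nat set" where
  "tree_elems h n = node ` nodes h n \<union> {peak v i | v i. v @ [i] \<in> nodes h n}"

definition tree_rel :: "nat \<Rightarrow> nat \<Rightarrow> nat rel" where
  "tree_rel h n = {(p, q). p \<in> tree_elems h n \<and> q \<in> tree_elems h n \<and> tree_le p q}"

lemma in_tree_elems [simp]:
  "node x \<in> tree_elems h n \<longleftrightarrow> x \<in> nodes h n"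
  "peak v i \<in> tree_elems h n \<longleftrightarrow> v @ [i] \<in> nodes h n"
  by (auto simp: tree_elems_def)

lemma tree_elems_cases [consumes 1, case_names node peak]:
  assumes "p \<in> tree_elems h n"
  obtains x where "p = node x" "x \<in> nodes h n" | v i where "p = peak v i" "v @ [i] \<in> nodes h n"
  using assms by (auto simp: tree_elems_def)

lemma nodes_append: "x @ y \<in> nodes h n \<Longrightarrow> x \<in> nodes h n"
  by (auto simp: nodes_def)

lemma Nil_in_nodes [simp]: "[] \<in> nodes h n"
  by (simp add: nodes_def)

lemma finite_tree_elems: "finite (tree_elems h n)"
proof -
  have fin: "finite (nodes h n)"
    using finite_lists_length_le[of "{..<n}" h] by (simp add: nodes_def conj_commute)
  have "{peak v i | v i. v @ [i] \<in> nodes h n} \<subseteq> (\<lambda>x. peak (butlast x) (last x)) ` nodes h n"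
    by (auto intro!: image_eqI[where x = "_ @ [_]"])
  then show ?thesis
    using fin by (simp add: tree_elems_def finite_subset)
qed

lemma tree_elems_nonempty: "tree_elems h n \<noteq> {}"
  by (metis Nil_in_nodes empty_iff in_tree_elems(1))

lemma tree_rel_partial_order: "partial_order_on (tree_elems h n) (tree_rel h n)"
proof -
  have "tree_le p p" if "p \<in> tree_elems h n" for p
    using that by (cases rule: tree_elems_cases) auto
  moreover have "tree_le p t" if "tree_le p q" "tree_le q t" for p q t
    using that by (elim tree_le.cases) (auto simp: prefix_def)
  moreover have "p = q" if "tree_le p q" "tree_le q p" for p q
    using that by (elim tree_le.cases) auto
  ultimately show ?thesis
    by (auto simp: order_on_defs refl_on_def trans_def antisym_def tree_rel_def)
qed

subsection \<open>Linear orders on the tree poset\<close>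

lemma append_le_append [simp]:
  "(xs @ ys :: 'k::linorder list) \<le> xs @ zs \<longleftrightarrow> ys \<le> zs"
  by (induction xs) auto

text \<open>
  Children have indices below \<open>n\<close>, so the last entries \<open>n + \<sigma> i\<close> and \<open>2 * n\<close> place,
  after the subtrees of the children of a node, first its peaks and then the node itself.
\<close>

definition postkey :: "nat \<Rightarrow> (nat \<Rightarrow> nat) \<Rightarrow> nat \<Rightarrow> nat list" where
  "postkey n \<sigma> = elem_case (\<lambda>x. map \<sigma> x @ [2 * n]) (\<lambda>v i. map \<sigma> v @ [n + \<sigma> i])"

text \<open>Nodes come first, in postorder, then all peaks, those with deeper branching points
  later. This serves the pairs that no postorder can: a peak is put above the nodes on the path to
  its branching point, and above peaks that branch at a proper prefix.\<close>

definition depthkey :: "nat \<Rightarrow> nat \<Rightarrow> nat list" where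
  "depthkey n = elem_case (\<lambda>x. 0 # x @ [2 * n]) (\<lambda>v i. Suc (length v) # v @ [i])"

text \<open>Intended for one peak and the branch that it misses. The empty key puts the peak at the
  bottom, which is allowed as no node of that branch lies below it.\<close>

definition branchkey :: "nat \<Rightarrow> nat \<Rightarrow> nat list" where
  "branchkey n = elem_case (\<lambda>x. x @ [2 * n]) (\<lambda>v i. [])"

definition address :: "nat \<Rightarrow> nat list" where
  "address = elem_case (\<lambda>x. x) (\<lambda>v i. v)"

definition flip :: "nat \<Rightarrow> nat \<Rightarrow> nat" where
  "flip n i = n - Suc i"

lemma key_simps [simp]:
  "postkey n \<sigma> (node x) = map \<sigma> x @ [2 * n]"
  "postkey n \<sigma> (peak v i) = map \<sigma> v @ [n + \<sigma> i]"
  "depthkey n (node x) = 0 # x @ [2 * n]"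
  "depthkey n (peak v i) = Suc (length v) # v @ [i]"
  "branchkey n (node x) = x @ [2 * n]"
  "branchkey n (peak v i) = []"
  "address (node x) = x"
  "address (peak v i) = v"
  by (simp_all add: postkey_def depthkey_def branchkey_def address_def)

text \<open>Entries below \<open>n\<close> are child steps, those from \<open>n\<close> to
  \<open>2 * n - 1\<close> mark peaks, and \<open>2 * n\<close> marks a node. As these ranges are
  disjoint and increasing, keys are injective and descendants come first, whatever the permutation
  of the children.\<close>

lemma ple_postkey:
  assumes \<sigma>: "\<And>i. i < n \<Longrightarrow> \<sigma> i < n" "inj_on \<sigma> {..<n}" and "X \<subseteq> tree_elems h n"
  shows "ple (tree_elems h n) (tree_rel h n) (keyed_order X (postkey n \<sigma>))"
proof (rule ple_keyed_order)
  have map_eq: "x = y" if "set x \<subseteq> {..<n}" "set y \<subseteq> {..<n}" "map \<sigma> x = map \<sigma> y" for x y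
    using that inj_on_map_eq_map[of \<sigma> x y] \<sigma>(2) by (meson Un_least inj_on_subset)
  have "inj_on (postkey n \<sigma>) (tree_elems h n)"
  proof (rule inj_onI)
    fix p q assume "p \<in> tree_elems h n" "q \<in> tree_elems h n" "postkey n \<sigma> p = postkey n \<sigma> q"
    then show "p = q"
      using \<sigma>(1) map_eq inj_onD[OF \<sigma>(2)]
      by (elim tree_elems_cases) (fastforce simp: nodes_def)+
  qed
  then show "inj_on (postkey n \<sigma>) X"
    using assms(3) inj_on_subset by blast
next
  fix p q assume "p \<in> X" "q \<in> X" "(p, q) \<in> tree_rel h n"
  then have "p \<in> tree_elems h n" "tree_le p q" by (auto simp: tree_rel_def)
  from this(2,1) show "postkey n \<sigma> p \<le> postkey n \<sigma> q"
  proof cases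
    case (node_node y z)
    with \<open>p \<in> tree_elems h n\<close> \<sigma>(1) show ?thesis by (cases z) (fastforce simp: nodes_def)+
  next
    case (node_peak i j v z)
    with \<open>p \<in> tree_elems h n\<close> \<sigma>(1)[of j] show ?thesis by (auto simp: nodes_def)
  qed auto
qed fact

lemma ple_depthkey:
  assumes "X \<subseteq> tree_elems h n"
  shows "ple (tree_elems h n) (tree_rel h n) (keyed_order X (depthkey n))"
proof (rule ple_keyed_order)
  show "inj_on (depthkey n) X"
  proof (rule inj_onI)
    fix p q assume "p \<in> X" "q \<in> X" "depthkey n p = depthkey n q"
    moreover from this assms have "p \<in> tree_elems h n" "q \<in> tree_elems h n" by auto
    ultimately show "p = q"
      by (elim tree_elems_cases) auto
  qed
next
  fix p q assume "p \<in> X" "q \<in> X" "(p, q) \<in> tree_rel h n"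
  then have "p \<in> tree_elems h n" "tree_le p q" by (auto simp: tree_rel_def)
  from this(2,1) show "depthkey n p \<le> depthkey n q"
  proof cases
    case (node_node y z)
    with \<open>p \<in> tree_elems h n\<close> show ?thesis by (cases z) (fastforce simp: nodes_def)+
  qed auto
qed fact

lemma ple_branchkey:
  assumes "X \<subseteq> tree_elems h n"
    and "\<And>p. p \<in> X \<Longrightarrow> p = peak v i \<or> (\<exists>z. p = node (v @ i # z))"
  shows "ple (tree_elems h n) (tree_rel h n) (keyed_order X (branchkey n))"
proof (rule ple_keyed_order)
  show "inj_on (branchkey n) X"
  proof (rule inj_onI)
    fix p q assume "p \<in> X" "q \<in> X" "branchkey n p = branchkey n q"
    then show "p = q" using assms(2)[of p] assms(2)[of q] by auto
  qed
next
  fix p q assume pq: "p \<in> X" "q \<in> X" "(p, q) \<in> tree_rel h n"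
  then have "p \<in> tree_elems h n" "tree_le p q" by (auto simp: tree_rel_def)
  from this(2,1) show "branchkey n p \<le> branchkey n q"
  proof cases
    case (node_node y z)
    with \<open>p \<in> tree_elems h n\<close> show ?thesis by (cases z) (fastforce simp: nodes_def)+
  next
    case (node_peak i j v z)
    with pq assms(2)[of p] assms(2)[of q] show ?thesis by auto
  qed auto
qed fact

lemma flip_simps:
  "i < n \<Longrightarrow> flip n i < n" "inj_on (flip n) {..<n}"
  "i < n \<Longrightarrow> j < n \<Longrightarrow> flip n i < flip n j \<longleftrightarrow> j < i"
  by (auto simp: flip_def inj_on_def)

lemma ple_postorders:
  assumes "X \<subseteq> tree_elems h n"
  shows "ple (tree_elems h n) (tree_rel h n) (keyed_order X (postkey n id))"
    "ple (tree_elems h n) (tree_rel h n) (keyed_order X (postkey n (flip n)))"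
  using assms flip_simps by (auto intro!: ple_postkey)

subsection \<open>Upper bounds\<close>

lemma antisym_tree_rel: "antisym (tree_rel h n)"
  using tree_rel_partial_order by (simp add: order_on_defs)

lemma address_bounded:
  assumes "p \<in> tree_elems h n"
  shows "set (address p) \<subseteq> {..<n}"
  using assms by (cases rule: tree_elems_cases) (auto simp: nodes_def)

lemma postkey_address:
  assumes "p \<in> tree_elems h n"
  obtains c where "postkey m \<sigma> p = map \<sigma> (address p) @ [c]"
  using assms by (cases rule: tree_elems_cases) auto

text \<open>The first differing entry of the addresses decides, and \<open>id\<close> and
  \<open>flip n\<close> decide in opposite ways.\<close>

lemma divergent_reversed:
  assumes "p \<in> tree_elems h n" "q \<in> tree_elems h n"
    and "address p = w @ i # x" "address q = w @ j # y" "i \<noteq> j"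
  shows "(q, p) \<in> keyed_order (tree_elems h n) (postkey n id) \<or>
         (q, p) \<in> keyed_order (tree_elems h n) (postkey n (flip n))"
proof -
  have "i < n" "j < n"
    using address_bounded[OF assms(1)] address_bounded[OF assms(2)] assms(3,4) by auto
  then have "j < i \<or> flip n j < flip n i"
    using assms(5) by (auto simp: flip_simps)
  moreover have "postkey n \<sigma> q \<le> postkey n \<sigma> p" if "\<sigma> j < \<sigma> i" for \<sigma>
  proof -
    obtain c d where "postkey n \<sigma> p = map \<sigma> (address p) @ [c]" "postkey n \<sigma> q = map \<sigma> (address q) @ [d]"
      using postkey_address[OF assms(1)] postkey_address[OF assms(2)] by metis
    with assms(3,4) that show ?thesis by simp
  qed
  ultimately show ?thesis
    using assms(1,2) by (auto simp: in_keyed_order)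
qed

lemma list_trichotomy:
  obtains z where "x = y @ z" | k z where "y = x @ k # z"
    | w i j u v where "x = w @ i # u" "y = w @ j # v" "i \<noteq> j"
proof (cases "prefix y x")
  case False
  show ?thesis
  proof (cases "prefix x y")
    case True
    then obtain z where "y = x @ z" by (auto simp: prefix_def)
    with False that(2) show ?thesis by (cases z) auto
  next
    case False
    with \<open>\<not> prefix y x\<close> parallel_decomp[of x y] that(3) show ?thesis by blast
  qed
qed (use that(1) in \<open>auto simp: prefix_def\<close>)

text \<open>
  The two postorder traversals already put every peak below the nodes above its branching point;
  \<open>inner_elems\<close> leaves the deepest nodes out of the depth order because they have already
  used up their \<open>h + 2\<close> occurrences.
\<close>

definition inner_elems :: "nat \<Rightarrow> nat \<Rightarrow> nat set" where
  "inner_elems h n = {p \<in> tree_elems h n. \<forall>x. p = node x \<longrightarrow> length x < h}"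

definition branch_elems :: "nat \<Rightarrow> nat \<Rightarrow> nat list \<Rightarrow> nat \<Rightarrow> nat set" where
  "branch_elems h n v i = {p \<in> tree_elems h n. p = peak v i \<or> (\<exists>z. p = node (v @ i # z))}"

lemma ple_branch:
  "ple (tree_elems h n) (tree_rel h n) (keyed_order (branch_elems h n v i) (branchkey n))"
  by (rule ple_branchkey[where v = v and i = i]) (auto simp: branch_elems_def)

definition tree_realizer :: "nat \<Rightarrow> nat \<Rightarrow> nat rel set" where
  "tree_realizer h n =
     {keyed_order (tree_elems h n) (postkey n id), keyed_order (tree_elems h n) (postkey n (flip n)),
      keyed_order (inner_elems h n) (depthkey n)} \<union>
     {keyed_order (branch_elems h n v i) (branchkey n) | v i. v @ [i] \<in> nodes h n}"

text \<open>Compare addresses. The two postorders settle divergent ones, and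
  \<open>postkey n id\<close> suffices if \<open>q\<close> sits strictly deeper than
  \<open>p\<close>. If the address of \<open>q\<close> is a prefix of that of \<open>p\<close>, the
  kinds of the two elements decide.\<close>

lemma tree_realizer: "local_realizer (tree_elems h n) (tree_rel h n) (tree_realizer h n)"
proof (rule local_realizerI)
  fix L assume "L \<in> tree_realizer h n"
  then show "ple (tree_elems h n) (tree_rel h n) L"
    using ple_branch ple_postorders[OF order.refl] ple_depthkey[of "inner_elems h n" h n]
    unfolding tree_realizer_def inner_elems_def by blast
next
  let ?E = "tree_elems h n"
  let ?K = "keyed_order ?E (postkey n id)" and ?K' = "keyed_order ?E (postkey n (flip n))"
    and ?N = "keyed_order (inner_elems h n) (depthkey n)"
  fix p q
  assume pq: "p \<in> ?E" "q \<in> ?E" "(p, q) \<notin> tree_rel h n"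
  then have nle: "\<not> tree_le p q" by (auto simp: tree_rel_def)
  have "(q, p) \<in> ?K \<or> (q, p) \<in> ?K' \<or> (q, p) \<in> ?N \<or>
      (\<exists>v i. v @ [i] \<in> nodes h n \<and> (q, p) \<in> keyed_order (branch_elems h n v i) (branchkey n))"
  proof (cases "address p" "address q" rule: list_trichotomy)
    case (3 w i j u v)
    then show ?thesis using divergent_reversed pq(1,2) by blast
  next
    case (1 z)
    from pq(1,2) show ?thesis
    proof (cases rule: tree_elems_cases[case_product tree_elems_cases])
      case (node_peak x v i)
      \<comment> \<open>For empty \<open>z\<close> the peak precedes its branching node in a
        postorder. Otherwise \<open>z\<close> starts with \<open>i\<close>, as \<open>p\<close> is
        not below \<open>q\<close>, and the branch member of \<open>peak v i\<close> reverses the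
        pair.\<close>
      with 1 nle pq show ?thesis
        by (cases z) (auto simp: in_keyed_order branch_elems_def nodes_def)
    next
      case (peak_node v i x)
      \<comment> \<open>Here \<open>x\<close> is a prefix of \<open>v\<close> and \<open>v\<close>
        has a child, so \<open>length x < h\<close> and \<open>node x\<close> takes part in the
        depth order.\<close>
      with 1 pq have "(q, p) \<in> ?N"
        by (auto simp: in_keyed_order inner_elems_def nodes_def)
      then show ?thesis by blast
    next
      case (peak_peak v i w j)
      show ?thesis
      proof (cases z)
        case Nil
        with peak_peak 1 nle pq have "j < i \<or> flip n j < flip n i"
          by (auto simp: flip_simps nodes_def)
        with Nil peak_peak 1 pq show ?thesis
          by (auto simp: in_keyed_order)
      next
        case Cons
        with peak_peak 1 pq have "(q, p) \<in> ?N"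
          by (auto simp: in_keyed_order inner_elems_def)
        then show ?thesis by blast
      qed
    qed (use 1 nle in auto)
  next
    case (2 k z)
    have "k < n" using pq(2) 2 by (cases rule: tree_elems_cases) (auto simp: nodes_def)
    with 2 pq have "(q, p) \<in> ?K"
      by (elim tree_elems_cases) (auto simp: in_keyed_order)
    then show ?thesis by blast
  qed
  then show "\<exists>L\<in>tree_realizer h n. (q, p) \<in> L"
    by (auto simp: tree_realizer_def)
qed (rule antisym_tree_rel)

text \<open>A node lies in both postorders, in one branch member per step of its path and, unless it
  has depth \<open>h\<close>, in the depth order. A peak lies in at most four members, which is
  where \<open>h \<ge> 2\<close> enters.\<close>

lemma realizable_tree:
  assumes "h \<ge> 2"
  shows "realizable (tree_elems h n) (tree_rel h n) (h + 2)"
  unfolding realizable_def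
proof (intro exI[of _ "tree_realizer h n"] conjI ballI tree_realizer)
  let ?K = "keyed_order (tree_elems h n) (postkey n id)"
    and ?K' = "keyed_order (tree_elems h n) (postkey n (flip n))"
    and ?N = "keyed_order (inner_elems h n) (depthkey n)"
    and ?M = "\<lambda>v i. keyed_order (branch_elems h n v i) (branchkey n)"
  fix p assume p: "p \<in> tree_elems h n"
  let ?S = "{L \<in> tree_realizer h n. p \<in> Field L}"
  show "1 \<le> mu_at p (tree_realizer h n)"
    using p by (intro mu_at_pos[OF finite_tree_elems tree_realizer, of ?K]) (auto simp: tree_realizer_def)
  from p have "card ?S \<le> h + 2"
  proof (cases rule: tree_elems_cases)
    case (node x)
    let ?I = "if length x < h then {?N} else {}"
    let ?T = "(\<lambda>m. ?M (take m x) (x ! m)) ` {..<length x}"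
    have "?S \<subseteq> {?K, ?K'} \<union> ?I \<union> ?T"
    proof
      fix L assume "L \<in> ?S"
      then consider "L \<in> {?K, ?K'}" | "L = ?N" "node x \<in> inner_elems h n"
        | v i z where "L = ?M v i" "x = v @ i # z"
        using node by (auto simp: tree_realizer_def branch_elems_def)
      then show "L \<in> {?K, ?K'} \<union> ?I \<union> ?T"
      proof cases
        case 2 then show ?thesis by (auto simp: inner_elems_def)
      next
        case (3 v i z)
        then have "L = ?M (take (length v) x) (x ! length v)" "length v < length x" by auto
        then show ?thesis by blast
      qed auto
    qed
    then have "card ?S \<le> card ({?K, ?K'} \<union> ?I \<union> ?T)"
      by (intro card_mono) auto
    also have "\<dots> \<le> card {?K, ?K'} + card ?I + card ?T"
      using card_Un_le[of "{?K, ?K'} \<union> ?I" ?T] card_Un_le[of "{?K, ?K'}" ?I] by linarith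
    also have "\<dots> \<le> 2 + card ?I + length x"
      using card_image_le[of "{..<length x}" "\<lambda>m. ?M (take m x) (x ! m)"]
      by (intro add_mono) (simp_all add: card_insert_if)
    also have "\<dots> \<le> h + 2"
      using node by (auto simp: nodes_def)
    finally show ?thesis .
  next
    case (peak v i)
    have "?S \<subseteq> {?K, ?K', ?N, ?M v i}"
      using peak by (auto simp: tree_realizer_def branch_elems_def)
    then have "card ?S \<le> card {?K, ?K', ?N, ?M v i}"
      by (intro card_mono) auto
    also have "\<dots> \<le> 4" by (simp add: card_insert_if)
    finally show ?thesis using assms by simp
  qed
  then show "mu_at p (tree_realizer h n) \<le> h + 2" by (simp add: mu_at_def)
qed

section \<open>The bound for a single standard example\<close>

definition star :: "nat \<Rightarrow> nat \<Rightarrow> nat list \<Rightarrow> nat set" where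
  "star h n v = {p \<in> tree_elems h n. p = node v \<or> (\<exists>i. p = node (v @ [i]) \<or> p = peak v i)}"

text \<open>\<open>?K\<close> lists children and peaks in descending order, \<open>?N\<close> in
  ascending order, with \<open>node v\<close> on opposite sides of the peaks. What remains is to
  reverse each child with the peak of its index, in a two-element member of their own.\<close>

lemma realizable_star: "realizable (star h n v) (Restr (tree_rel h n) (star h n v)) 3"
  unfolding realizable_def
proof (intro exI conjI ballI)
  let ?S = "star h n v"
  let ?K = "keyed_order ?S (postkey n (flip n))" and ?N = "keyed_order ?S (depthkey n)"
    and ?M = "\<lambda>i. keyed_order {node (v @ [i]), peak v i} (branchkey n)"
  let ?L = "{?K, ?N} \<union> ?M ` {i. v @ [i] \<in> nodes h n}"
  have sub: "?S \<subseteq> tree_elems h n" by (auto simp: star_def)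
  have Restr: "ple ?S (Restr (tree_rel h n) ?S) L"
    if "ple (tree_elems h n) (tree_rel h n) L" "Field L \<subseteq> ?S" for L
  proof -
    have "Restr L ?S = L" using that(2) by (auto simp: Field_def)
    with ple_Restr[OF that(1), of ?S] show ?thesis by simp
  qed
  show realizer: "local_realizer ?S (Restr (tree_rel h n) ?S) ?L"
  proof (rule local_realizerI)
    show "antisym (Restr (tree_rel h n) ?S)"
      using antisym_tree_rel by (rule antisym_subset[rotated]) auto
    fix L assume "L \<in> ?L"
    then show "ple ?S (Restr (tree_rel h n) ?S) L"
      by (auto intro!: Restr ple_postorders ple_depthkey ple_branchkey[of _ _ _ v] sub) (auto simp: star_def)
  next
    fix p q
    assume pq: "p \<in> ?S" "q \<in> ?S" "(p, q) \<notin> Restr (tree_rel h n) ?S"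
    then have nle: "\<not> tree_le p q" by (auto simp: tree_rel_def star_def)
    have lt: "i < n" if "node (v @ [i]) \<in> ?S \<or> peak v i \<in> ?S" for i
      using that by (auto simp: star_def nodes_def)
    have "(q, p) \<in> ?K \<or> (q, p) \<in> ?N \<or> (\<exists>i. v @ [i] \<in> nodes h n \<and> (q, p) \<in> ?M i)"
    proof -
      consider "p = node v" | i where "p = node (v @ [i])" | i where "p = peak v i"
        using pq(1) by (auto simp: star_def)
      then show ?thesis
      proof cases
        case 1
        with pq nle lt show ?thesis
          by (auto simp: star_def in_keyed_order flip_simps nodes_def trans_less_add1)
      next
        case (2 i)
        with pq nle have "(\<exists>j. q = node (v @ [j]) \<and> i \<noteq> j) \<or> q = peak v i"
          by (auto simp: star_def)
        then show ?thesis
        proof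
          assume "q = peak v i"
          with 2 pq have "v @ [i] \<in> nodes h n \<and> (q, p) \<in> ?M i"
            by (auto simp: in_keyed_order star_def)
          then show ?thesis by blast
        next
          assume "\<exists>j. q = node (v @ [j]) \<and> i \<noteq> j"
          then obtain j where j: "q = node (v @ [j])" "i \<noteq> j" by blast
          with lt pq 2 have "j < i \<or> flip n j < flip n i" by (auto simp: flip_simps)
          with j 2 pq show ?thesis by (auto simp: in_keyed_order)
        qed
      next
        case (3 i)
        have "(\<exists>x. q = node x) \<or> (\<exists>j. q = peak v j \<and> i \<noteq> j)"
          using pq nle 3 by (auto simp: star_def)
        then show ?thesis
        proof
          assume "\<exists>x. q = node x"
          with 3 pq show ?thesis by (auto simp: in_keyed_order)
        next
          assume "\<exists>j. q = peak v j \<and> i \<noteq> j"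
          then obtain j where j: "q = peak v j" "i \<noteq> j" by blast
          with lt pq 3 have "j < i \<or> flip n j < flip n i" by (auto simp: flip_simps)
          with j 3 pq show ?thesis by (auto simp: in_keyed_order)
        qed
      qed
    qed
    then show "\<exists>L\<in>?L. (q, p) \<in> L" by auto
  qed
  fix p assume p: "p \<in> ?S"
  let ?T = "{L \<in> ?L. p \<in> Field L}"
  show "1 \<le> mu_at p ?L"
    using finite_subset[OF sub finite_tree_elems] realizer p by (intro mu_at_pos[of _ _ _ ?K]) auto
  obtain i where "\<forall>j. p \<in> {node (v @ [j]), peak v j} \<longrightarrow> j = i"
    using p by (fastforce simp: star_def)
  then have "?T \<subseteq> {?K, ?N, ?M i}"
    by auto
  then have "card ?T \<le> card {?K, ?N, ?M i}"
    by (intro card_mono) auto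
  also have "\<dots> \<le> 3" by (simp add: card_insert_if)
  finally show "mu_at p ?L \<le> 3" by (simp add: mu_at_def)
qed

subsection \<open>The lower bound\<close>

text \<open>For distinct siblings, the two reversals and two relations of the poset would close a
  cycle in \<open>L\<close>: \<open>peak v i\<close>, the node in branch \<open>i\<close>,
  \<open>peak v j\<close>, the node in branch \<open>j\<close>, and back.\<close>

lemma sibling_conflict:
  assumes L: "ple (tree_elems h n) (tree_rel h n) L"
    and "(peak v i, node (v @ i # x)) \<in> L" "(peak v j, node (v @ j # y)) \<in> L"
  shows "i = j"
proof (rule ccontr)
  assume "i \<noteq> j"
  have field: "peak v i \<in> Field L" "node (v @ i # x) \<in> Field L"
    "peak v j \<in> Field L" "node (v @ j # y) \<in> Field L"
    using assms(2,3) by (auto simp: Field_def)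
  with pleD(2)[OF L] \<open>i \<noteq> j\<close>
  have "(node (v @ i # x), peak v j) \<in> Restr (tree_rel h n) (Field L)"
    "(node (v @ j # y), peak v i) \<in> Restr (tree_rel h n) (Field L)"
    by (auto simp: tree_rel_def)
  with pleD(3)[OF L] have "(node (v @ i # x), peak v j) \<in> L" "(node (v @ j # y), peak v i) \<in> L"
    by auto
  with assms(2,3) ple_trans[OF L] have "(node (v @ i # x), peak v i) \<in> L" by blast
  with assms(2) ple_antisym[OF L] have "node (v @ i # x) = peak v i" by blast
  then show False by simp
qed

text \<open>Pigeonhole: if every \<open>C j\<close> met \<open>U\<close>, choosing common elements
  would embed \<open>J\<close> into the smaller set \<open>U\<close>.\<close>

lemma disjoint_choice:
  assumes "finite J" "finite U" "card U < card J"
    and "\<And>i j. i \<in> J \<Longrightarrow> j \<in> J \<Longrightarrow> C i \<inter> C j \<noteq> {} \<Longrightarrow> i = j"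
  obtains j where "j \<in> J" "C j \<inter> U = {}"
proof (rule ccontr)
  assume "\<not> thesis"
  then have "\<forall>j\<in>J. \<exists>L. L \<in> C j \<inter> U" using that by blast
  then obtain f where f: "\<And>j. j \<in> J \<Longrightarrow> f j \<in> C j \<inter> U" by metis
  have "inj_on f J"
    by (rule inj_onI) (metis f assms(4) IntD1 IntI empty_iff)
  moreover have "f ` J \<subseteq> U" using f by auto
  ultimately have "card J \<le> card U" using assms(2) by (rule card_inj_on_le)
  with assms(3) show False by simp
qed

text \<open>
  Here \<open>U\<close> collects all partial linear extensions that contain \<open>node [0]\<close> or that reverse a
  peak along the path to \<open>x\<close>. By \<open>sibling_conflict\<close>, siblings use disjoint families to
  reverse their peaks, so with many children some child only uses members outside \<open>U\<close>.
\<close>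

lemma greedy_descent:
  assumes \<L>: "local_realizer (tree_elems h n) (tree_rel h n) \<L>"
    and k: "\<And>u. u \<in> tree_elems h n \<Longrightarrow> mu_at u \<L> \<le> k"
    and n: "k * (h + 1) + 1 < n" and m: "m \<le> h"
  shows "\<exists>x U. x \<in> nodes h n \<and> length x = m \<and> (x \<noteq> [] \<longrightarrow> hd x \<noteq> 0) \<and>
    U \<subseteq> \<L> \<and> card U \<le> k * (m + 1) \<and>
    (\<forall>z. x @ z \<in> nodes h n \<and> length (x @ z) = h \<and> x @ z \<noteq> [] \<and> hd (x @ z) \<noteq> 0 \<longrightarrow>
      m + 2 \<le> card {L \<in> U. node (x @ z) \<in> Field L})"
  using m
proof (induction m)
  case 0
  \<comment> \<open>Both orders between the reference \<open>node [0]\<close> and a leaf outside its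
    branch occur in \<open>U\<close>, in different members; this is the initial 2.\<close>
  define U where "U = {L \<in> \<L>. node [0] \<in> Field L}"
  have fin: "finite \<L>" using finite_ples[OF finite_tree_elems \<L>] .
  show ?case
  proof (intro exI[of _ "[]"] exI[of _ U] conjI allI impI)
    show "card U \<le> k * (0 + 1)"
    proof (cases "node [0] \<in> tree_elems h n")
      case True
      with k[of "node [0]"] show ?thesis by (simp add: U_def mu_at_def)
    next
      case False
      then have "U = {}"
        using pleD(2)[OF local_realizer_ple[OF \<L>]] unfolding U_def by blast
      then show ?thesis by simp
    qed
    fix z assume z: "[] @ z \<in> nodes h n \<and> length ([] @ z) = h \<and> [] @ z \<noteq> [] \<and> hd ([] @ z) \<noteq> 0"
    then have elems: "node [0] \<in> tree_elems h n" "node z \<in> tree_elems h n"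
      using n by (cases z; auto simp: nodes_def)+
    have "(node [0], node z) \<notin> tree_rel h n" "(node z, node [0]) \<notin> tree_rel h n"
      using z by (cases z; auto simp: tree_rel_def)+
    with \<L> elems obtain L L' where L: "L \<in> \<L>" "(node [0], node z) \<in> L" "L' \<in> \<L>" "(node z, node [0]) \<in> L'"
      unfolding local_realizer_def by blast
    have "node [0] \<noteq> node z" using z by auto
    with L ple_antisym[OF local_realizer_ple[OF \<L>]] have "L \<noteq> L'" by blast
    moreover have "{L, L'} \<subseteq> {L \<in> U. node z \<in> Field L}"
      using L by (auto simp: U_def Field_def)
    then have "card {L, L'} \<le> card {L \<in> U. node z \<in> Field L}"
      using fin by (intro card_mono) (auto simp: U_def)
    ultimately show "0 + 2 \<le> card {L \<in> U. node ([] @ z) \<in> Field L}" by simp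
  qed (auto simp: U_def)
next
  case (Suc m)
  then obtain x U where x: "x \<in> nodes h n" "length x = m" "x \<noteq> [] \<longrightarrow> hd x \<noteq> 0"
    and U: "U \<subseteq> \<L>" "card U \<le> k * (m + 1)"
    and ext: "\<And>z. x @ z \<in> nodes h n \<Longrightarrow> length (x @ z) = h \<Longrightarrow> x @ z \<noteq> [] \<Longrightarrow> hd (x @ z) \<noteq> 0 \<Longrightarrow>
      m + 2 \<le> card {L \<in> U. node (x @ z) \<in> Field L}"
    by auto
  have fin: "finite \<L>" using finite_ples[OF finite_tree_elems \<L>] .
  then have finU: "finite U" using U(1) finite_subset by blast
  \<comment> \<open>All members of \<open>C j\<close> contain \<open>peak x j\<close>, so one step
    of the descent adds at most \<open>k\<close> members to \<open>U\<close>.\<close>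
  define C where "C j = {L \<in> \<L>. \<exists>z. (peak x j, node (x @ j # z)) \<in> L}" for j
  have "k * (m + 1) \<le> k * (h + 1)" using Suc.prems by (intro mult_le_mono) auto
  with U(2) n have "card U < n - 1" by linarith
  \<comment> \<open>Child 0 is barred to keep the path out of the branch of \<open>node [0]\<close>;
    the \<open>+ 1\<close> in the bound on \<open>n\<close> pays for it.\<close>
  then have "card U < card {1..<n}" by simp
  moreover have "i = j" if "C i \<inter> C j \<noteq> {}" for i j
    using that sibling_conflict[OF local_realizer_ple[OF \<L>]] by (auto simp: C_def)
  ultimately obtain j where j: "j \<in> {1..<n}" "C j \<inter> U = {}"
    using disjoint_choice[of "{1..<n}" U C] finU by blast
  have xj: "x @ [j] \<in> nodes h n" using x j Suc.prems by (auto simp: nodes_def)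
  show ?case
  proof (intro exI[of _ "x @ [j]"] exI[of _ "U \<union> C j"] conjI allI impI)
    have "C j \<subseteq> {L \<in> \<L>. peak x j \<in> Field L}"
      by (auto simp: C_def Field_def)
    then have "card (C j) \<le> mu_at (peak x j) \<L>"
      unfolding mu_at_def using fin by (intro card_mono) auto
    also have "\<dots> \<le> k" using k xj by simp
    finally show "card (U \<union> C j) \<le> k * (Suc m + 1)"
      using card_Un_le[of U "C j"] U(2) by simp
    show "hd (x @ [j]) \<noteq> 0" using x(3) j(1) by (cases x) auto
    show "U \<union> C j \<subseteq> \<L>" using U(1) by (auto simp: C_def)
    fix z
    assume z: "(x @ [j]) @ z \<in> nodes h n \<and> length ((x @ [j]) @ z) = h \<and> (x @ [j]) @ z \<noteq> [] \<and>
      hd ((x @ [j]) @ z) \<noteq> 0"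
    let ?S = "{L \<in> U. node (x @ j # z) \<in> Field L}"
      and ?T = "{L \<in> U \<union> C j. node ((x @ [j]) @ z) \<in> Field L}"
    have "(node (x @ j # z), peak x j) \<notin> tree_rel h n" "(peak x j, node (x @ j # z)) \<notin> tree_rel h n"
      by (auto simp: tree_rel_def)
    moreover have "node (x @ j # z) \<in> tree_elems h n" "peak x j \<in> tree_elems h n"
      using z xj by auto
    ultimately obtain L where L: "L \<in> \<L>" "(peak x j, node (x @ j # z)) \<in> L"
      using \<L> unfolding local_realizer_def by blast
    then have "L \<in> C j" "node (x @ j # z) \<in> Field L" by (auto simp: C_def Field_def)
    \<comment> \<open>The member reversing the new peak is outside \<open>U\<close>, so the leaf
      gains an occurrence.\<close>
    with j(2) have "L \<notin> ?S" "insert L ?S \<subseteq> ?T" by auto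
    moreover have "finite ?T" using finU fin by (auto simp: C_def)
    ultimately have "card ?S + 1 \<le> card ?T"
      using finU card_mono[of ?T "insert L ?S"] by simp
    with ext[of "j # z"] z show "Suc m + 2 \<le> card ?T" by simp
  qed (use x(2) xj in auto)
qed

text \<open>If no element occurred more than \<open>h + 1\<close> times, the descent with
  \<open>k = h + 1\<close> to depth \<open>h\<close> would end at a leaf with \<open>h + 2\<close>
  occurrences. By \<open>1 \<le> h\<close> this leaf is not the root.\<close>

lemma ldim_tree_ge:
  assumes "realizable (tree_elems h n) (tree_rel h n) d" and "1 \<le> h" "(h + 1) * (h + 1) + 1 < n"
  shows "h + 2 \<le> ldim (tree_elems h n) (tree_rel h n)"
  using assms(1) finite_tree_elems tree_elems_nonempty
proof (rule ldim_ge)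
  fix \<L> assume \<L>: "local_realizer (tree_elems h n) (tree_rel h n) \<L>"
  show "\<exists>u\<in>tree_elems h n. h + 2 \<le> mu_at u \<L>"
  proof (rule ccontr)
    assume neg: "\<not> ?thesis"
    then have "mu_at u \<L> \<le> h + 1" if "u \<in> tree_elems h n" for u using that by force
    from greedy_descent[OF \<L> this assms(3) order.refl] obtain x U
      where x: "x \<in> nodes h n" "length x = h" "x \<noteq> [] \<longrightarrow> hd x \<noteq> 0" "U \<subseteq> \<L>"
        and U: "\<And>z. x @ z \<in> nodes h n \<Longrightarrow> length (x @ z) = h \<Longrightarrow> x @ z \<noteq> [] \<Longrightarrow> hd (x @ z) \<noteq> 0 \<Longrightarrow>
          h + 2 \<le> card {L \<in> U. node (x @ z) \<in> Field L}"
      by blast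
    have "h + 2 \<le> card {L \<in> U. node x \<in> Field L}"
    proof -
      have "x \<noteq> []" using x(2) assms(2) by auto
      with U[of "[]"] x(1-3) show ?thesis by simp
    qed
    also have "\<dots> \<le> mu_at (node x) \<L>"
      unfolding mu_at_def using x(4) finite_ples[OF finite_tree_elems \<L>]
      by (intro card_mono) auto
    finally show False using neg x(1) by auto
  qed
qed

subsection \<open>The blocks\<close>

text \<open>What hangs at \<open>node u\<close>. The peaks branching at \<open>u\<close> belong to
  it, being comparable only to themselves and to proper descendants of \<open>u\<close>.\<close>

definition below :: "nat list \<Rightarrow> nat set" where
  "below u = {node (u @ k # z) | k z. True} \<union> {peak (u @ z) i | z i. True}"

lemma node_notin_below [simp]: "node u \<notin> below u"
  by (auto simp: below_def)

text \<open>\<open>below u\<close> is a down-set, so \<open>q\<close> lies above \<open>p\<close>.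
  Then \<open>q\<close> is a node on the path to \<open>u\<close>, or a peak branching strictly
  above \<open>u\<close>, and such a peak does not tell \<open>u\<close> from its
  descendants.\<close>

lemma below_separated:
  assumes "p \<in> below u" "q \<notin> below u" "tree_le p q \<or> tree_le q p"
  shows "tree_le p (node u) \<and> tree_le (node u) q"
proof -
  have "\<not> tree_le q p"
  proof
    assume "tree_le q p"
    then have "q \<in> below u"
    proof cases
      case (node_node y z)
      with assms(1) show ?thesis by (auto simp: below_def)
    next
      case (node_peak i j v z)
      with assms(1) show ?thesis
        by (auto simp: below_def) (metis Cons_eq_appendI append.assoc neq_Nil_conv append_Nil)
    qed (use assms(1) in auto)
    with assms(2) show False by simp
  qed
  with assms(3) have "tree_le p q" by simp
  then show ?thesis
  proof cases
    case (node_node y z)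
    show ?thesis
      using node_node assms(1,2)
      by (cases u y rule: list_trichotomy) (auto simp: below_def)
  next
    case (node_peak i j v z)
    show ?thesis
      using node_peak assms(1,2)
      by (cases u v rule: list_trichotomy) (auto simp: below_def Cons_eq_append_conv)
  qed (use assms(1,2) in auto)
qed

text \<open>Otherwise \<open>node u\<close> would lie strictly between \<open>p\<close> and
  \<open>q\<close>. So \<open>node u\<close> separates \<open>below u\<close> from the rest of the
  cover graph.\<close>

lemma below_separated_covers:
  assumes "covers (tree_elems h n) (tree_rel h n) p q \<or> covers (tree_elems h n) (tree_rel h n) q p"
    and "p \<in> below u" "q \<notin> below u"
  shows "q = node u"
proof -
  have elems: "p \<in> tree_elems h n" "q \<in> tree_elems h n"
    and "tree_le p q \<or> tree_le q p"
    using assms(1) by (auto simp: covers_def tree_rel_def)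
  then have le: "tree_le p (node u)" "tree_le (node u) q"
    using below_separated assms(2,3) by blast+
  have "u \<in> nodes h n"
    using elems(1) assms(2) by (auto simp: below_def dest: nodes_append)
  then have "(p, node u) \<in> tree_rel h n" "(node u, q) \<in> tree_rel h n"
    using le elems by (auto simp: tree_rel_def)
  moreover from this have "(q, p) \<notin> tree_rel h n"
    using assms(2,3) antisymD[OF antisym_tree_rel] \<open>tree_le p q \<or> tree_le q p\<close> 
    by (metis tree_rel_partial_order partial_order_onD(2) transD)
  moreover have "p \<noteq> node u" using assms(2) by auto
  ultimately show ?thesis
    using assms(1) \<open>u \<in> nodes h n\<close> by (auto simp: covers_def)
qed

lemma poset_blockD:
  assumes "poset_block A r B"
  shows "B \<subseteq> A" "B \<noteq> {}" "two_connected (with_proj (cover_graph B (Restr r B)))"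
    "parcs (cover_graph B (Restr r B)) \<subseteq> parcs (cover_graph A r)"
proof -
  let ?H = "with_proj (cover_graph B (Restr r B))"
  have "subgraph ?H (with_proj (cover_graph A r))" and tc: "two_connected ?H" and "B \<subseteq> A"
    using assms
    by (auto simp: poset_block_def graph_block_def pre_digraph.max_subgraph_def convex_subposet_def)
  then show "B \<subseteq> A" "two_connected ?H" "parcs (cover_graph B (Restr r B)) \<subseteq> parcs (cover_graph A r)"
    by (simp_all add: subgraph_def)
  from tc have "connected ?H" by (simp add: two_connected_def)
  then show "B \<noteq> {}"
    by (auto simp: connected_def strongly_connected_def mk_symmetric_def cover_graph_def)
qed

text \<open>Take the deepest \<open>v\<close> such that \<open>B\<close> consists of elements of
  \<open>below v\<close> and possibly \<open>node v\<close>. Then \<open>B\<close> avoids whatever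
  hangs at a child of \<open>v\<close>, which leaves \<open>v\<close>, its children and its
  peaks.\<close>

lemma tree_block_in_star:
  assumes "poset_block (tree_elems h n) (tree_rel h n) B"
  obtains v where "B \<subseteq> star h n v"
proof -
  note block = poset_blockD[OF assms]
  have dichotomy: "B \<subseteq> insert (node u) (below u) \<or> B \<inter> below u = {}" for u
  proof -
    let ?H = "with_proj (cover_graph B (Restr (tree_rel h n) B))"
    have "verts ?H \<subseteq> insert (node u) (below u) \<or> verts ?H \<inter> below u = {}"
    proof (rule two_connected_no_cut)
      fix e assume e: "e \<in> arcs ?H" "tail ?H e \<noteq> node u" "head ?H e \<noteq> node u"
      then obtain p q where "e = (p, q)" by (cases e)
      with e block(4) have
        "covers (tree_elems h n) (tree_rel h n) p q \<or> covers (tree_elems h n) (tree_rel h n) q p"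
        by (auto simp: cover_graph_def)
      with e \<open>e = (p, q)\<close> show "tail ?H e \<in> below u \<longleftrightarrow> head ?H e \<in> below u"
        using below_separated_covers[of h n p q u] below_separated_covers[of h n q p u] by auto
    qed (use block in auto)
    then show ?thesis by (simp add: cover_graph_def)
  qed
  define P where "P u \<longleftrightarrow> u \<in> nodes h n \<and> B \<subseteq> insert (node u) (below u)" for u
  have "p \<in> insert (node []) (below [])" if "p \<in> tree_elems h n" for p
    using that
  proof (cases rule: tree_elems_cases)
    case (node x)
    then show ?thesis by (cases x) (auto simp: below_def)
  qed (auto simp: below_def)
  then have "P []" using block(1) by (auto simp: P_def)
  moreover have "length u \<le> h" if "P u" for u
    using that by (auto simp: P_def nodes_def)
  ultimately obtain v where v: "P v" "\<And>u. P u \<Longrightarrow> length u \<le> length v"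
    using ex_has_greatest_nat[of P "[]" length "Suc h"] by (metis le_imp_less_Suc)
  \<comment> \<open>The other alternative of the dichotomy would make \<open>v @ [k]\<close> a
    deeper choice than \<open>v\<close>.\<close>
  have child: "B \<inter> below (v @ [k]) = {}" if "v @ [k] \<in> nodes h n" for k
    using dichotomy[of "v @ [k]"] v(2)[of "v @ [k]"] that by (auto simp: P_def)
  have "p \<in> star h n v" if "p \<in> B" for p
  proof -
    have p: "p \<in> tree_elems h n" using that block(1) by auto
    from that v(1) consider "p = node v" | k z where "p = node (v @ k # z)" | z i where "p = peak (v @ z) i"
      by (auto simp: P_def below_def)
    then show ?thesis
    proof cases
      case (2 k z)
      have "v @ [k] \<in> nodes h n" using p 2 nodes_append[of "v @ [k]" z] by simp
      with child[of k] that 2 have "z = []"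
        by (cases z) (auto simp: below_def)
      with 2 p show ?thesis by (simp add: star_def)
    next
      case (3 z i)
      have "z = []"
      proof (cases z)
        case (Cons k z')
        have "v @ [k] \<in> nodes h n" using p 3 Cons nodes_append[of "v @ [k]" "z' @ [i]"] by simp
        with child[of k] that 3 Cons show ?thesis by (auto simp: below_def)
      qed
      with 3 p show ?thesis by (simp add: star_def)
    qed (use p in \<open>simp add: star_def\<close>)
  qed
  with that show thesis by blast
qed

lemma ldim_tree_block_le:
  assumes "poset_block (tree_elems h n) (tree_rel h n) B"
  shows "ldim B (Restr (tree_rel h n) B) \<le> 3"
proof -
  obtain v where v: "B \<subseteq> star h n v" using tree_block_in_star[OF assms] .
  have "finite (star h n v)" using finite_tree_elems by (simp add: star_def)
  then have "realizable B (Restr (Restr (tree_rel h n) (star h n v)) B) 3" "finite B"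
    using realizable_subset[OF realizable_star] v finite_subset by auto
  moreover have "Restr (Restr (tree_rel h n) (star h n v)) B = Restr (tree_rel h n) B"
    using v by auto
  ultimately show ?thesis
    using ldim_le[of B _ 3] poset_blockD(2)[OF assms] by simp
qed

text \<open>For \<open>h = 1\<close> the whole poset is one star, whose bound 3 equals
  \<open>h + 2\<close>; the traversals give the upper bound for larger \<open>h\<close>.\<close>

lemma ldim_tree:
  assumes "1 \<le> h" "(h + 1) * (h + 1) + 1 < n"
  shows "ldim (tree_elems h n) (tree_rel h n) = h + 2"
proof -
  have "realizable (tree_elems h n) (tree_rel h n) (h + 2)"
  proof (cases "h = 1")
    case True
    have "star h n [] = tree_elems h n"
      using True by (auto simp: star_def nodes_def length_Suc_conv le_Suc_eq elim!: tree_elems_cases)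
    moreover have "Restr (tree_rel h n) (tree_elems h n) = tree_rel h n"
      by (auto simp: tree_rel_def)
    ultimately show ?thesis using realizable_star[of h n "[]"] True by (simp add: numeral_3_eq_3)
  qed (use assms realizable_tree in auto)
  then show ?thesis
    using ldim_tree_ge[OF _ assms] ldim_le[OF _ finite_tree_elems tree_elems_nonempty]
    by (metis le_antisym)
qed

section \<open>Dimensions one and two, and the conclusion\<close>

lemma realizable_antichain_pair: "realizable {0, 1 :: nat} (Id_on {0, 1}) 2"
proof -
  let ?K = "keyed_order {0, 1} int" and ?K' = "keyed_order {0, 1} (\<lambda>i. - int i)"
  have real: "local_realizer {0, 1} (Id_on {0, 1}) {?K, ?K'}"
  proof (rule local_realizerI)
    fix L assume "L \<in> {?K, ?K'}"
    then show "ple {0, 1} (Id_on {0, 1}) L"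
      by (auto intro!: ple_keyed_order simp: inj_on_def)
  qed (auto simp: in_keyed_order antisym_def)
  have "1 \<le> mu_at u {?K, ?K'} \<and> mu_at u {?K, ?K'} \<le> 2" if "u \<in> {0, 1}" for u
  proof
    show "1 \<le> mu_at u {?K, ?K'}"
      using that by (intro mu_at_pos[OF _ real, of ?K]) auto
    have "card {L \<in> {?K, ?K'}. u \<in> Field L} \<le> card {?K, ?K'}"
      by (intro card_mono) auto
    also have "\<dots> \<le> 2" by (simp add: card_insert_if)
    finally show "mu_at u {?K, ?K'} \<le> 2" by (simp add: mu_at_def)
  qed
  with real show ?thesis by (auto simp: realizable_def)
qed

lemma ldim_antichain_pair: "ldim {0, 1 :: nat} (Id_on {0, 1}) = 2"
proof (rule antisym)
  show "ldim {0, 1 :: nat} (Id_on {0, 1}) \<le> 2"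
    using ldim_le[OF realizable_antichain_pair] by simp
  show "2 \<le> ldim {0, 1 :: nat} (Id_on {0, 1})"
  proof (rule ldim_ge[OF realizable_antichain_pair])
    fix \<L> assume \<L>: "local_realizer {0, 1 :: nat} (Id_on {0, 1}) \<L>"
    then obtain L L' where L: "L \<in> \<L>" "(0, 1) \<in> L" "L' \<in> \<L>" "(1, 0) \<in> L'"
      unfolding local_realizer_def by (metis Id_onE Pair_inject insertI1 insertI2 zero_neq_one)
    then have "L \<noteq> L'"
      using ple_antisym[OF local_realizer_ple[OF \<L>], of L 0 1] by auto
    have fin: "finite \<L>" using finite_ples[OF _ \<L>] by simp
    have "{L, L'} \<subseteq> {L \<in> \<L>. 0 \<in> Field L}" using L by (auto simp: Field_def)
    with fin have "card {L, L'} \<le> card {L \<in> \<L>. 0 \<in> Field L}"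
      by (intro card_mono) auto
    with \<open>L \<noteq> L'\<close> show "\<exists>u\<in>{0, 1}. 2 \<le> mu_at u \<L>" by (simp add: mu_at_def)
  qed auto
qed

lemma realizable_singleton: "realizable {0 :: nat} {(0, 0)} 1"
proof -
  have keyed: "keyed_order {0 :: nat} id = {(0, 0)}" by (auto simp: keyed_order_def)
  have real: "local_realizer {0 :: nat} {(0, 0)} {{(0, 0)}}"
  proof (rule local_realizerI)
    fix L :: "nat rel" assume "L \<in> {{(0, 0)}}"
    then show "ple {0 :: nat} {(0, 0)} L"
      using ple_keyed_order[of "{0 :: nat}" "{0}" id "{(0, 0)}", unfolded keyed] by simp
  qed (auto simp: antisym_def)
  moreover have "mu_at 0 {{(0 :: nat, 0 :: nat)}} = 1"
  proof -
    have "{L \<in> {{(0 :: nat, 0 :: nat)}}. 0 \<in> Field L} = {{(0, 0)}}" by (auto simp: Field_def)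
    then show ?thesis by (simp add: mu_at_def)
  qed
  ultimately show ?thesis by (auto simp: realizable_def)
qed

lemma ldim_singleton: "ldim {0 :: nat} {(0, 0)} = 1"
  using ldim_le[OF realizable_singleton] ldim_attained[OF realizable_singleton]
  by (metis One_nat_def Suc_leI finite.emptyI finite_insert insert_not_empty le_antisym)

text \<open>A realizer of the whole poset restricts to each block, so the small examples need no
  analysis of their blocks.\<close>

lemma block_ldim_le:
  assumes "realizable A r k" "finite A" "poset_block A r B" "k \<le> 3"
  shows "ldim B (Restr r B) \<le> 3"
  using assms realizable_subset[OF assms(1,2)] poset_blockD(1,2)[OF assms(3)]
  by (meson finite_subset ldim_le le_trans)

theorem theorem4:
  fixes d :: nat
  assumes "d \<ge> 1"
  shows "\<exists>(A :: nat set) r. finite A \<and> A \<noteq> {} \<and> partial_order_on A r \<and>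
           ldim A r = d \<and>
           (\<forall>B. poset_block A r B \<longrightarrow> ldim B (Restr r B) \<le> 3)"
proof -
  \<comment> \<open>Trees with \<open>1 \<le> h\<close> only reach dimensions from 3 on.\<close>
  consider "d = 1" | "d = 2" | h where "d = h + 2" "1 \<le> h"
  proof -
    have "d = (d - 2) + 2 \<and> 1 \<le> d - 2" if "d \<noteq> 1" "d \<noteq> 2" using assms that by linarith
    with that show ?thesis by blast
  qed
  then show ?thesis
  proof cases
    case 1
    show ?thesis
    proof (intro exI[of _ "{0}"] exI[of _ "{(0, 0)}"] conjI allI impI)
      show "partial_order_on {0 :: nat} {(0, 0)}"
        by (auto simp: order_on_defs refl_on_def trans_def antisym_def)
    qed (use 1 ldim_singleton block_ldim_le[OF realizable_singleton] in auto)
  next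
    case 2
    show ?thesis
    proof (intro exI[of _ "{0, 1}"] exI[of _ "Id_on {0, 1}"] conjI allI impI)
      show "partial_order_on {0, 1 :: nat} (Id_on {0, 1})"
        by (auto simp: order_on_defs refl_on_def trans_def antisym_def)
    qed (use 2 ldim_antichain_pair block_ldim_le[OF realizable_antichain_pair] in auto)
  next
    case (3 h)
    \<comment> \<open>The least number of children that satisfies the hypothesis of the lower
      bound.\<close>
    define n where "n = (h + 1) * (h + 1) + 2"
    have "ldim (tree_elems h n) (tree_rel h n) = d"
      using ldim_tree[of h n] 3 by (simp add: n_def)
    then show ?thesis
      using finite_tree_elems tree_elems_nonempty tree_rel_partial_order ldim_tree_block_le
      by (intro exI[of _ "tree_elems h n"] exI[of _ "tree_rel h n"]) auto
  qed
qed

end
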